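(* Let $n\ge1$, let $v\in Z_4^n$ be a column vector, and for $i=0,1,2,3$ let $f_i$ be the number of entries of $v$ equal to $i$. Let $D$ be the two-level $2^{2n}\times(2n+2)$ design generated by $G=(v,I_n)$, and let $D'$ be a half-fraction of $D$. Define $k_1=f_1+2f_2+f_3+1$, $k_2=2f_1+2f_3+2$ and $\rho=2^{-\lfloor (f_1+f_3)/2\rfloor}$. (a) If the branching column is associated with number 1 or 3, then $D'$ has 1 complete word of length $k_2-1$, $1/\rho^2$ partial words of length $k_1$ with aliasing index $\rho$, and $1/\rho^2$ partial words of length $k_1-1$ with aliasing index $\rho$ (these being pairwise distinct, and $D'$ having no other words). (b) If the branching column is associated with number 2, then $D'$ has 1 complete word of length $k_2$ and $2/\rho^2$ partial words of length $k_1-1$ with aliasing index $\rho$ (these being pairwise distinct, and $D'$ having no other words).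
   Context: $Z_4=\{0,1,2,3\}$ is the ring of integers modulo 4. Design generated by $G=(v,I_n)$: let $C$ be the $2^{2n}\times(n+1)$ matrix whose rows are all linear combinations $uG$, $u\in Z_4^n$. Replace each entry of $C$ by a pair of $\pm1$ symbols via the Gray map $0\mapsto(1,1)$, $1\mapsto(1,-1)$, $2\mapsto(-1,-1)$, $3\mapsto(-1,1)$, so that column $j$ of $C$ becomes columns $2j-1,2j$. The result $D$ is a $2^{2n}\times(2n+2)$ matrix with entries $\pm1$ (a two-level design; rows are runs, columns are factors; row order is irrelevant). A column of $D$ is associated with number $z\in\{0,1,2,3\}$ if it is one of the two columns of $D$ arising from the $i$th column of $I_n$ for some $i$ such that the $i$th entry of $v$ is $z$ (i.e. columns $2i+1,2i+2$ of $D$). Half-fraction: choose a column of $D$ (the branching column), keep only the runs in which this column takes one fixed symbol ($+1$ or $-1$), and delete the branching column; this gives a $2^{2n-1}\times(2n+1)$ design $D'$. For a two-level design with $N$ runs and a nonempty set $s$ of $k$ of its columns, let $j_k(s)=\sum_{i=1}^N\prod_{c\in s}c_i$, where $c_i$ is the $i$th entry of column $c$, and let the aliasing index be $\rho_k(s)=|j_k(s)|/N\in[0,1]$. If $\rho_k(s)>0$, the set $s$ is a word of length $k$ with aliasing index $\rho_k(s)$; it is a complete word if the aliasing index is 1, and otherwise a partial word (a "partial word with aliasing index 1" is allowed as a name for a complete word). If $\rho_k(s)=0$, $s$ is not a word. *)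

theory Defs
  imports "HOL-Analysis.Analysis"
begin

(* Z_4 is the numeral type 4 of HOL-Library.Numeral_Type: a commutative ring of four
   elements with arithmetic modulo 4.  As a value of this type, 4 equals 0. *)

definition gray :: "4 \<Rightarrow> int \<times> int" where
  "gray z =
     (if z = 0 then (1, 1)
      else if z = 1 then (1, -1)
      else if z = 2 then (-1, -1)
      else (-1, 1))"

(* The row order of a design is irrelevant, so its runs form a finite index set.  They are
   labelled, so runs with the same entries are counted with multiplicity.  Columns are
   labelled as well, so deleting one does not renumber the others. *)

record ('r, 'c) design =
  runs :: "'r set"
  cols :: "'c set"
  entry :: "'r \<Rightarrow> 'c \<Rightarrow> int"

(* Run u is the Gray image of the row u G.  The pair of columns coming from column j of the
   generator G is (j, False), the first Gray component, and (j, True), the second one. *)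

definition generated_design :: "4 ^ 'm ^ 'n \<Rightarrow> (4 ^ 'n, 'm \<times> bool) design" where
  "generated_design G =
     \<lparr> runs = UNIV,
       cols = UNIV,
       entry = (\<lambda>u (j, h). (if h then snd else fst) (gray ((u v* G) $ j))) \<rparr>"

(* The n x (n+1) matrix (v, I_n): column None is v, column Some i is the i-th column of I_n. *)

definition generator :: "4 ^ 'n \<Rightarrow> 4 ^ ('n option) ^ 'n" where
  "generator v = (\<chi> i j. case j of None \<Rightarrow> v $ i | Some k \<Rightarrow> mat 1 $ i $ k)"

definition associated_with :: "4 ^ 'n \<Rightarrow> 'n option \<times> bool \<Rightarrow> 4 \<Rightarrow> bool" where
  "associated_with v b z \<longleftrightarrow> (\<exists>i. fst b = Some i \<and> v $ i = z)"

definition half_fraction :: "('r, 'c) design \<Rightarrow> 'c \<Rightarrow> int \<Rightarrow> ('r, 'c) design" where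
  "half_fraction D b e =
     \<lparr> runs = {r \<in> runs D. entry D r b = e},
       cols = cols D - {b},
       entry = entry D \<rparr>"

definition j_char :: "('r, 'c) design \<Rightarrow> 'c set \<Rightarrow> int" where
  "j_char D s = (\<Sum>r\<in>runs D. \<Prod>c\<in>s. entry D r c)"

definition aliasing_index :: "('r, 'c) design \<Rightarrow> 'c set \<Rightarrow> real" where
  "aliasing_index D s = \<bar>real_of_int (j_char D s)\<bar> / real (card (runs D))"

definition words :: "('r, 'c) design \<Rightarrow> 'c set set" where
  "words D = {s. s \<subseteq> cols D \<and> s \<noteq> {} \<and> aliasing_index D s > 0}"

(* Aliasing index 1 is allowed here: words counted as partial words of index rho may be
   complete words, which happens when rho = 1. *)

definition words_with :: "('r, 'c) design \<Rightarrow> nat \<Rightarrow> real \<Rightarrow> 'c set set" where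
  "words_with D k r = {s \<in> words D. card s = k \<and> aliasing_index D s = r}"

definition complete_words :: "('r, 'c) design \<Rightarrow> nat \<Rightarrow> 'c set set" where
  "complete_words D k = words_with D k 1"

end

(* On Z_4 every product of Gray components is the real part of a constant times a character,
   z |-> Re (c * i^(d z)), so j(s) = Re (c * prod_i (local character sum in u_i)).  A local sum
   is 0 or 4 for even v_i and 0 or 2 (1 +- i) for odd v_i; hence s is nonempty with j(s) nonzero
   only for one complete word, which contains both columns of v, and for words containing
   exactly one column of v, for which |j(s)| / N is rho because a product of k factors 1 +- i
   has real part 0 or +- 2^(k div 2).  Parseval over all column sets gives
   1 + 1 + rho^2 * #partial = 4, so there are 2 / rho^2 partial words.

   In a half-fraction 2 j'(s) = j(s) + e j(s + b); for v_i nonzero s, s + b are never both words, so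
   the words of D' are the words of D with b deleted.  For odd v_i each partial word contains
   exactly one of the two columns of i, and u |-> -u swaps the two, so half of the partial
   words contain b; for v_i = 2 all of them do. *)

theory Submission
  imports Defs
begin

section \<open>Designs and their half-fractions\<close>

text \<open>Expanding the square and summing over all \<open>s\<close> first gives, for each pair of
  runs, the product over all columns of 1 plus the product of the two entries. A column where the
  runs differ contributes the factor 0, so only the diagonal survives.\<close>

lemma parseval:
  assumes "finite (runs D)" "finite (cols D)"
    and sq: "\<And>r c. r \<in> runs D \<Longrightarrow> c \<in> cols D \<Longrightarrow> (entry D r c)\<^sup>2 = 1"
    and distinct: "\<And>r r'. r \<in> runs D \<Longrightarrow> r' \<in> runs D \<Longrightarrow> r \<noteq> r' \<Longrightarrow>
                     \<exists>c\<in>cols D. entry D r c \<noteq> entry D r' c"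
  shows "(\<Sum>s\<in>Pow (cols D). (j_char D s)\<^sup>2) = 2 ^ card (cols D) * int (card (runs D))"
proof -
  have pm: "entry D r c = 1 \<or> entry D r c = -1" if "r \<in> runs D" "c \<in> cols D" for r c
    using sq[OF that] by (simp add: power2_eq_1_iff)
  have agree: "(\<Prod>c\<in>cols D. entry D r c * entry D r' c + 1) = (if r = r' then 2 ^ card (cols D) else 0)"
    if r: "r \<in> runs D" and r': "r' \<in> runs D" for r r'
  proof (cases "r = r'")
    case True
    have "(\<Prod>c\<in>cols D. entry D r c * entry D r' c + 1) = (\<Prod>c\<in>cols D. 2)"
      using sq[OF r] True by (intro prod.cong) (simp_all add: power2_eq_square)
    then show ?thesis using True by simp
  next
    case False
    then obtain c where c: "c \<in> cols D" "entry D r c \<noteq> entry D r' c"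
      using distinct r r' by blast
    then have "entry D r c * entry D r' c + 1 = 0"
      using pm[OF r c(1)] pm[OF r' c(1)] by auto
    then show ?thesis using False c(1) assms(2) by (auto intro: prod_zero)
  qed
  have "(\<Sum>s\<in>Pow (cols D). (j_char D s)\<^sup>2) =
      (\<Sum>s\<in>Pow (cols D). \<Sum>r\<in>runs D. \<Sum>r'\<in>runs D. \<Prod>c\<in>s. entry D r c * entry D r' c)"
    by (simp add: j_char_def power2_eq_square sum_product prod.distrib)
  also have "\<dots> = (\<Sum>r\<in>runs D. \<Sum>r'\<in>runs D. \<Sum>s\<in>Pow (cols D). \<Prod>c\<in>s. entry D r c * entry D r' c)"
    by (subst sum.swap, rule sum.cong[OF refl], rule sum.swap)
  also have "\<dots> = (\<Sum>r\<in>runs D. \<Sum>r'\<in>runs D. \<Prod>c\<in>cols D. entry D r c * entry D r' c + 1)"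
    by (simp add: prod_add assms(2))
  also have "\<dots> = (\<Sum>r\<in>runs D. \<Sum>r'\<in>runs D. if r = r' then 2 ^ card (cols D) else 0)"
    by (intro sum.cong refl agree)
  also have "\<dots> = 2 ^ card (cols D) * int (card (runs D))"
    using assms(1) by (simp add: mult.commute)
  finally show ?thesis .
qed

text \<open>Twice the indicator of the retained runs is 1 + e x, where x is the entry in column
  \<open>b\<close>; multiplying by x adjoins \<open>b\<close> to \<open>s\<close>. The factor 2
  keeps the identity integral.\<close>

lemma j_char_half_fraction:
  assumes "finite (runs D)" "finite s" "b \<notin> s" and e: "e = 1 \<or> e = -1"
    and sq: "\<And>r. r \<in> runs D \<Longrightarrow> (entry D r b)\<^sup>2 = 1"
  shows "2 * j_char (half_fraction D b e) s = j_char D s + e * j_char D (insert b s)"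
proof -
  have sel: "(if entry D r b = e then 2 else 0) = 1 + e * entry D r b" if "r \<in> runs D" for r
    using e sq[OF that] by (auto simp: power2_eq_1_iff)
  have "2 * j_char (half_fraction D b e) s =
      (\<Sum>r\<in>runs D. (if entry D r b = e then 2 else 0) * (\<Prod>c\<in>s. entry D r c))"
    using assms(1)
    by (simp add: j_char_def half_fraction_def sum_distrib_left sum.inter_filter) (auto intro!: sum.cong)
  also have "\<dots> = (\<Sum>r\<in>runs D. (1 + e * entry D r b) * (\<Prod>c\<in>s. entry D r c))"
    by (intro sum.cong refl) (simp only: sel)
  also have "\<dots> = j_char D s + e * j_char D (insert b s)"
    using assms(2,3) by (simp add: j_char_def sum.distrib sum_distrib_left algebra_simps)
  finally show ?thesis .
qed

text \<open>The vanishing of \<open>j_char D {b}\<close> means that column \<open>b\<close> is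
  balanced, so exactly half of the runs remain and the two factors 2 cancel.\<close>

lemma aliasing_index_half_fraction:
  assumes "finite (runs D)" "finite s" "b \<notin> s" "e = 1 \<or> e = -1"
    and "\<And>r. r \<in> runs D \<Longrightarrow> (entry D r b)\<^sup>2 = 1"
    and b: "j_char D {b} = 0"
  shows "aliasing_index (half_fraction D b e) s =
      \<bar>real_of_int (j_char D s + e * j_char D (insert b s))\<bar> / real (card (runs D))"
proof -
  \<comment> \<open>The empty set of columns counts the runs, its products being 1.\<close>
  have "2 * j_char (half_fraction D b e) {} = j_char D {}"
    using j_char_half_fraction[of D "{}" b e] assms by simp
  then have "2 * int (card (runs (half_fraction D b e))) = int (card (runs D))"
    by (simp add: j_char_def)
  then have "2 * card (runs (half_fraction D b e)) = card (runs D)"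
    by linarith
  then have N: "real (card (runs D)) = 2 * real (card (runs (half_fraction D b e)))"
    by (metis of_nat_mult of_nat_numeral)
  have "real_of_int (j_char D s + e * j_char D (insert b s)) =
      2 * real_of_int (j_char (half_fraction D b e) s)"
    using j_char_half_fraction[of D s b e] assms by (metis of_int_mult of_int_numeral)
  then show ?thesis
    unfolding N by (simp add: aliasing_index_def abs_mult)
qed

text \<open>A nonzero sum needs at least one run, so the denominator of the index is then
  positive.\<close>

lemma mem_words_iff:
  assumes "finite (runs D)"
  shows "s \<in> words D \<longleftrightarrow> s \<subseteq> cols D \<and> s \<noteq> {} \<and> j_char D s \<noteq> 0"
proof -
  have "runs D \<noteq> {}" if "j_char D s \<noteq> 0"
    using that by (auto simp: j_char_def)
  then have "aliasing_index D s > 0 \<longleftrightarrow> j_char D s \<noteq> 0"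
    using assms by (auto simp: aliasing_index_def zero_less_divide_iff card_gt_0_iff
        simp del: of_int_sum of_int_prod)
  then show ?thesis by (simp add: words_def)
qed

text \<open>By \<open>apart\<close>, at most one of the terms j(s) and e j(s + b) is nonzero.
  Nothing cancels or adds up, so each word keeps its index when \<open>b\<close> is deleted. Balance
  of \<open>b\<close> rules out the word {b}, whose trace would be empty.\<close>

lemma half_fraction_words:
  fixes D :: "('r, 'c) design"
  assumes fin: "finite (runs D)" "finite (cols D)" and bD: "b \<in> cols D" and e: "e = 1 \<or> e = -1"
    and sq: "\<And>r. r \<in> runs D \<Longrightarrow> (entry D r b)\<^sup>2 = 1"
    and b: "j_char D {b} = 0"
    and apart: "\<And>s. s \<in> words D \<Longrightarrow> b \<notin> s \<Longrightarrow> insert b s \<notin> words D"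
  shows "words (half_fraction D b e) =
           {s \<in> words D. b \<notin> s} \<union> (\<lambda>s. s - {b}) ` {s \<in> words D. b \<in> s}" (is ?words)
    and "s \<in> words D \<Longrightarrow> aliasing_index (half_fraction D b e) (s - {b}) = aliasing_index D s"
proof -
  let ?J = "j_char D" and ?D = "half_fraction D b e"
  note word = mem_words_iff[OF fin(1)]
  have ai: "aliasing_index ?D s = \<bar>real_of_int (?J s + e * ?J (insert b s))\<bar> / real (card (runs D))"
    if "s \<subseteq> cols D" "b \<notin> s" for s
    using that fin by (intro aliasing_index_half_fraction e sq b) (auto intro: finite_subset)
  have abs_e: "\<bar>real_of_int e * x\<bar> = \<bar>x\<bar>" for x :: real
    using e by auto
  show index: "aliasing_index ?D (s - {b}) = aliasing_index D s" if s: "s \<in> words D" for s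
  proof (cases "b \<in> s")
    case True
    have "s - {b} \<noteq> {}"
    proof
      assume "s - {b} = {}"
      then have "s = {b}" using True by auto
      then show False using s b by (simp add: word)
    qed
    then have sub: "s - {b} \<subseteq> cols D" "insert b (s - {b}) = s" "s - {b} \<noteq> {}"
      using s True by (auto simp: word)
    then have "?J (s - {b}) = 0"
      using apart[of "s - {b}"] s word by auto
    then show ?thesis
      using ai[of "s - {b}"] sub by (simp add: aliasing_index_def abs_e)
  next
    case False
    then have "?J (insert b s) = 0"
      using apart[of s] s word bD by auto
    then show ?thesis
      using ai[of s] False s by (simp add: aliasing_index_def word)
  qed
  show ?words
  proof (intro equalityI subsetI)
    fix s assume s: "s \<in> words ?D"
    then have s': "s \<subseteq> cols D" "b \<notin> s" "s \<noteq> {}" and "aliasing_index ?D s \<noteq> 0"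
      by (auto simp: words_def half_fraction_def)
    then have "?J s + e * ?J (insert b s) \<noteq> 0"
      using ai[of s] by (metis abs_zero div_0 of_int_0)
    then have "?J s \<noteq> 0 \<or> ?J (insert b s) \<noteq> 0"
      by auto
    then show "s \<in> {s \<in> words D. b \<notin> s} \<union> (\<lambda>s. s - {b}) ` {s \<in> words D. b \<in> s}"
    proof
      assume "?J s \<noteq> 0"
      then show ?thesis using s' word by auto
    next
      assume "?J (insert b s) \<noteq> 0"
      then have "insert b s \<in> {s \<in> words D. b \<in> s}" "s = insert b s - {b}"
        using s' word bD by auto
      then show ?thesis by blast
    qed
  next
    fix s assume "s \<in> {s \<in> words D. b \<notin> s} \<union> (\<lambda>s. s - {b}) ` {s \<in> words D. b \<in> s}"
    then obtain t where t: "t \<in> words D" "s = t - {b}"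
      by auto
    moreover have "s \<noteq> {}"
    proof
      assume "s = {}"
      then have "t = {b} \<or> t = {}" using t by auto
      then show False using t(1) b by (auto simp: word)
    qed
    ultimately show "s \<in> words ?D"
      using index[OF t(1)] by (auto simp: words_def half_fraction_def)
  qed
qed

section \<open>Characters of the Gray map\<close>

lemma Z4_cases: "(z::4) = 0 \<or> z = 1 \<or> z = 2 \<or> z = 3"
  using exhaust_4[of z] by auto

lemma sum_Z4: "(\<Sum>z\<in>UNIV. f (z::4)) = f 0 + f 1 + f 2 + (f 3 :: 'a::comm_monoid_add)"
proof -
  \<comment> \<open>The sum in \<open>sum_4\<close> is over 1, 2, 3, 4, and the last of these is 0
    in Z_4.\<close>
  have "(4::4) = 0" by simp
  then have "f 4 = f 0" by (rule arg_cong)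
  then show ?thesis using sum_4[of f] by (simp add: ac_simps)
qed

lemma bool_set_cases: "S = {} \<or> S = {False} \<or> S = {True} \<or> S = (UNIV :: bool set)"
proof -
  have "S \<in> Pow {False, True}" by (auto simp: UNIV_bool)
  then show ?thesis by (auto simp: Pow_insert UNIV_bool)
qed

definition gray_bit :: "bool \<Rightarrow> 4 \<Rightarrow> int" where
  "gray_bit h z = (if h then snd else fst) (gray z)"

definition gray_prod :: "bool set \<Rightarrow> 4 \<Rightarrow> int" where
  "gray_prod S z = (\<Prod>h\<in>S. gray_bit h z)"

text \<open>The additive character z |-> i^z of Z_4.\<close>

definition quartic_char :: "4 \<Rightarrow> complex" where
  "quartic_char z = (if z = 0 then 1 else if z = 1 then \<i> else if z = 2 then -1 else -\<i>)"

text \<open>The Gray components are Re ((1 - i) i^z) and Re ((1 + i) i^z), and their product is Re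
  (i^(2 z)). \<open>phase\<close> records the constant in front of the character,
  \<open>freq\<close> the multiplier of z.\<close>

definition phase :: "bool set \<Rightarrow> complex" where
  "phase S = (if S = {False} then 1 - \<i> else if S = {True} then 1 + \<i> else 1)"

definition freq :: "bool set \<Rightarrow> 4" where
  "freq S = (if S = {} then 0 else if S = UNIV then 2 else 1)"

text \<open>Fourier transform of \<open>gray_prod S\<close> at frequency \<open>a\<close>: the
  factor that one coordinate of the run contributes.\<close>

definition gray_coeff :: "4 \<Rightarrow> bool set \<Rightarrow> complex" where
  "gray_coeff a S = (\<Sum>z\<in>UNIV. quartic_char (a * z) * of_int (gray_prod S z))"

lemma gray_bit_sq: "(gray_bit h z)\<^sup>2 = 1"
  by (simp add: gray_bit_def gray_def)

lemma gray_bit_uminus: "gray_bit h (- z) = gray_bit (\<not> h) z"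
  using Z4_cases[of z] by (auto simp: gray_bit_def gray_def)

lemma gray_bits_inject:
  assumes "\<And>h. gray_bit h y = gray_bit h z"
  shows "y = z"
  using assms[of False] assms[of True] Z4_cases[of y] Z4_cases[of z]
  by (auto simp: gray_bit_def gray_def)

lemma quartic_char_add: "quartic_char (y + z) = quartic_char y * quartic_char z"
  using Z4_cases[of y] Z4_cases[of z] by (elim disjE) (simp_all add: quartic_char_def)

lemma quartic_char_sum:
  "finite A \<Longrightarrow> quartic_char (\<Sum>i\<in>A. g i) = (\<Prod>i\<in>A. quartic_char (g i))"
  by (induction A rule: finite_induct) (simp_all add: quartic_char_add, simp add: quartic_char_def)

text \<open>Replaces a Gray product by a character, which will factor over the coordinates of a
  run.\<close>

lemma gray_prod_eq: "real_of_int (gray_prod S z) = Re (phase S * quartic_char (freq S * z))"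
  using bool_set_cases[of S] Z4_cases[of z]
  by (elim disjE)
    (simp_all add: gray_prod_def gray_bit_def gray_def phase_def freq_def quartic_char_def UNIV_bool)

text \<open>At an even frequency the character is itself a Gray product, so orthogonality leaves a
  single \<open>S\<close>. At an odd frequency its real and imaginary parts mix the two Gray
  components, and both singletons survive.\<close>

lemma gray_coeff_0: "gray_coeff 0 S = (if S = {} then 4 else 0)"
  using bool_set_cases[of S]
  by (elim disjE)
    (simp_all add: gray_coeff_def sum_Z4 gray_prod_def gray_bit_def gray_def quartic_char_def UNIV_bool)

lemma gray_coeff_2: "gray_coeff 2 S = (if S = UNIV then 4 else 0)"
  using bool_set_cases[of S]
  by (elim disjE)
    (simp_all add: gray_coeff_def sum_Z4 gray_prod_def gray_bit_def gray_def quartic_char_def UNIV_bool)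

lemma gray_coeff_1:
  "gray_coeff 1 S = (if S = {False} then 2 * (1 + \<i>) else if S = {True} then 2 * (1 - \<i>) else 0)"
  using bool_set_cases[of S]
  by (elim disjE)
    (simp_all add: gray_coeff_def sum_Z4 gray_prod_def gray_bit_def gray_def quartic_char_def UNIV_bool)

lemma gray_coeff_3:
  "gray_coeff 3 S = (if S = {False} then 2 * (1 - \<i>) else if S = {True} then 2 * (1 + \<i>) else 0)"
  using bool_set_cases[of S]
  by (elim disjE)
    (simp_all add: gray_coeff_def sum_Z4 gray_prod_def gray_bit_def gray_def quartic_char_def UNIV_bool)

section \<open>The design generated by \<open>(v, I)\<close>\<close>

lemma entry_generated_design [simp]:
  "entry (generated_design G) u (j, h) = gray_bit h ((u v* G) $ j)"
  by (simp add: generated_design_def gray_bit_def)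

lemma runs_generated_design [simp]: "runs (generated_design G) = UNIV"
  and cols_generated_design [simp]: "cols (generated_design G) = UNIV"
  by (simp_all add: generated_design_def)

lemma mult_generator_None [simp]: "(u v* generator v) $ None = (\<Sum>i\<in>UNIV. u $ i * v $ i)"
  by (simp add: vector_matrix_mult_def generator_def)

lemma mult_generator_Some [simp]: "(u v* generator v) $ Some i = u $ i"
  by (simp add: vector_matrix_mult_def generator_def mat_def if_distrib cong: if_cong)

lemma entry_generated_design_sq: "(entry (generated_design G) u c)\<^sup>2 = 1"
  by (cases c) (simp add: gray_bit_sq)

lemma prod_UNIV_option:
  "(\<Prod>j\<in>UNIV. g (j :: 'n::finite option)) = g None * (\<Prod>i\<in>UNIV. g (Some i) :: 'a::comm_monoid_mult)"
  by (simp add: UNIV_option_conv prod.reindex)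

lemma sum_UNIV_option:
  "(\<Sum>j\<in>UNIV. g (j :: 'n::finite option)) = g None + (\<Sum>i\<in>UNIV. g (Some i) :: 'a::comm_monoid_add)"
  by (simp add: UNIV_option_conv sum.reindex)

text \<open>A set of columns is read as a relation: its slice at j says which of the two Gray
  components of column j it contains. Products and cardinalities over \<open>s\<close> thereby split
  over j.\<close>

lemma Sigma_slices: "(SIGMA x:UNIV. s `` {x}) = s"
  by (simp add: set_eq_iff)

lemma prod_entry_generated_design:
  fixes s :: "('m::finite \<times> bool) set"
  shows "(\<Prod>c\<in>s. entry (generated_design G) u c) = (\<Prod>j\<in>UNIV. gray_prod (s `` {j}) ((u v* G) $ j))"
proof -
  have "(\<Prod>j\<in>UNIV. gray_prod (s `` {j}) ((u v* G) $ j)) =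
      (\<Prod>(j, h)\<in>(SIGMA j:UNIV. s `` {j}). gray_bit h ((u v* G) $ j))"
    unfolding gray_prod_def by (rule prod.Sigma) auto
  then show ?thesis
    unfolding Sigma_slices by (simp add: case_prod_unfold generated_design_def gray_bit_def)
qed

lemma card_eq_sum_slices:
  fixes s :: "('m::finite \<times> bool) set"
  shows "card s = (\<Sum>j\<in>UNIV. card (s `` {j}))"
proof -
  have "card (SIGMA j:UNIV. s `` {j}) = (\<Sum>j\<in>UNIV. card (s `` {j}))"
    by (rule card_SigmaI) auto
  then show ?thesis unfolding Sigma_slices .
qed

lemma sum_vec_prod:
  fixes g :: "'n::finite \<Rightarrow> 'b::finite \<Rightarrow> 'a::comm_semiring_1"
  shows "(\<Sum>u\<in>(UNIV :: ('b ^ 'n) set). \<Prod>i\<in>UNIV. g i (u $ i)) = (\<Prod>i\<in>UNIV. \<Sum>z\<in>UNIV. g i z)"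
proof -
  have "(\<Sum>u\<in>(UNIV :: ('b ^ 'n) set). \<Prod>i\<in>UNIV. g i (u $ i)) = (\<Sum>u\<in>UNIV. \<Prod>i\<in>UNIV. g i (u i))"
    by (rule sum.reindex_bij_witness[of _ vec_lambda vec_nth]) auto
  then show ?thesis
    by (simp add: prod_sum_PiE PiE_UNIV_domain)
qed

text \<open>Only the column of v couples the coordinates of a run u. Written as a character it
  factors over i; all other factors are real, so they move inside Re, and the sum over u becomes a
  product of one-coordinate sums.\<close>

lemma j_char_generator:
  fixes s :: "('n::finite option \<times> bool) set"
  shows "real_of_int (j_char (generated_design (generator v)) s) =
    Re (phase (s `` {None}) * (\<Prod>i\<in>UNIV. gray_coeff (freq (s `` {None}) * v $ i) (s `` {Some i})))"
proof -
  define H where "H = s `` {None}"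
  define S where "S i = s `` {Some i}" for i
  have Re_mult: "Re z * real_of_int k = Re (z * of_int k)" for z k
    by simp
  have run: "real_of_int (\<Prod>c\<in>s. entry (generated_design (generator v)) u c) =
      Re (phase H * (\<Prod>i\<in>UNIV. quartic_char (freq H * v $ i * u $ i) * of_int (gray_prod (S i) (u $ i))))"
    for u
  proof -
    have "real_of_int (\<Prod>c\<in>s. entry (generated_design (generator v)) u c) =
        real_of_int (gray_prod H (\<Sum>i\<in>UNIV. u $ i * v $ i)) * real_of_int (\<Prod>i\<in>UNIV. gray_prod (S i) (u $ i))"
      by (simp add: prod_entry_generated_design prod_UNIV_option H_def S_def)
    also have "\<dots> = Re (phase H * quartic_char (freq H * (\<Sum>i\<in>UNIV. u $ i * v $ i))
        * of_int (\<Prod>i\<in>UNIV. gray_prod (S i) (u $ i)))"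
      by (simp only: gray_prod_eq Re_mult)
    also have "freq H * (\<Sum>i\<in>UNIV. u $ i * v $ i) = (\<Sum>i\<in>UNIV. freq H * v $ i * u $ i)"
      by (simp add: sum_distrib_left ac_simps)
    finally show ?thesis
      by (simp add: quartic_char_sum prod.distrib mult.assoc)
  qed
  have "real_of_int (j_char (generated_design (generator v)) s) =
      Re (phase H * (\<Sum>u\<in>UNIV. \<Prod>i\<in>UNIV. quartic_char (freq H * v $ i * u $ i) * of_int (gray_prod (S i) (u $ i))))"
    by (simp only: j_char_def of_int_sum run runs_generated_design sum_distrib_left Re_sum)
  then show ?thesis
    by (simp only: sum_vec_prod[of "\<lambda>i z. quartic_char (freq H * v $ i * z) * of_int (gray_prod (S i) z)"]
        gray_coeff_def H_def[symmetric] S_def[symmetric])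
qed

lemma card_Z4_vec: "card (UNIV :: (4 ^ 'n::finite) set) = 4 ^ CARD('n)"
  by (simp add: CARD_vec)

definition gray_swap :: "'m \<times> bool \<Rightarrow> 'm \<times> bool" where
  "gray_swap c = (fst c, \<not> snd c)"

lemma gray_swap_gray_swap [simp]: "gray_swap (gray_swap c) = c"
  by (simp add: gray_swap_def)

lemma inj_gray_swap: "inj gray_swap"
  by (metis gray_swap_gray_swap injI)

text \<open>Negating a run \<open>u\<close> exchanges the two Gray components of every column.\<close>

lemma j_char_gray_swap:
  "j_char (generated_design G) (gray_swap ` s) = j_char (generated_design G) s"
proof -
  have flip: "entry (generated_design G) (- u) (gray_swap c) = entry (generated_design G) u c" for u c
  proof (cases c)
    case (Pair j h)
    have "((- u) v* G) $ j = - ((u v* G) $ j)"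
      by (simp add: vector_matrix_mult_def sum_negf)
    then show ?thesis by (simp add: Pair gray_swap_def gray_bit_uminus)
  qed
  have "j_char (generated_design G) (gray_swap ` s) =
      (\<Sum>u\<in>UNIV. \<Prod>c\<in>s. entry (generated_design G) u (gray_swap c))"
    by (simp add: j_char_def prod.reindex inj_on_subset[OF inj_gray_swap])
  also have "\<dots> = (\<Sum>u\<in>UNIV. \<Prod>c\<in>s. entry (generated_design G) (- u) (gray_swap c))"
    by (rule sum.reindex_bij_witness[of _ uminus uminus]) auto
  finally show ?thesis
    by (simp add: flip j_char_def)
qed

text \<open>The powers of \<open>\<surd>2\<close> times eighth roots of unity that arise as products of \<open>k\<close>
  factors \<open>1 \<plusminus> \<i>\<close>.\<close>

definition octant :: "nat \<Rightarrow> complex \<Rightarrow> bool" where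
  "octant k z \<longleftrightarrow>
     (if even k then \<bar>Re z\<bar> = 2 ^ (k div 2) \<and> Im z = 0 \<or> Re z = 0 \<and> \<bar>Im z\<bar> = 2 ^ (k div 2)
      else \<bar>Re z\<bar> = 2 ^ (k div 2) \<and> \<bar>Im z\<bar> = 2 ^ (k div 2))"

text \<open>Multiplying by 1 +- i turns by 45 degrees and stretches by the square root of 2. From an
  axis to a diagonal the nonzero coordinate keeps its absolute value; from a diagonal to an axis it
  doubles, just as \<open>k div 2\<close> goes up by one.\<close>

lemma octant_mult:
  assumes "octant k z" "w \<in> {1 + \<i>, 1 - \<i>}"
  shows "octant (Suc k) (z * w)"
proof (cases "even k")
  case True
  then show ?thesis using assms by (auto simp: octant_def)
next
  case False
  define p :: real where "p = 2 ^ (k div 2)"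
  have "\<bar>Re z\<bar> = p" "\<bar>Im z\<bar> = p"
    using assms(1) False by (simp_all add: octant_def p_def)
  then have "\<bar>Re z - Im z\<bar> = 2 * p \<and> Re z + Im z = 0 \<or> Re z - Im z = 0 \<and> \<bar>Re z + Im z\<bar> = 2 * p"
    by arith
  moreover have "(2::real) ^ (Suc k div 2) = 2 * p"
    using False by (simp add: p_def)
  ultimately show ?thesis
    using assms(2) False unfolding octant_def by (elim insertE) (auto simp: add.commute)
qed

lemma octant_prod:
  assumes "octant k z" "finite A" "\<And>i. i \<in> A \<Longrightarrow> w i \<in> {1 + \<i>, 1 - \<i>}"
  shows "octant (k + card A) (z * prod w A)"
  using assms(2,3)
proof (induction A rule: finite_induct)
  case (insert i A)
  have "octant (Suc (k + card A)) (z * prod w A * w i)"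
    using insert by (intro octant_mult) auto
  then show ?case using insert by (simp add: ac_simps)
qed (use assms(1) in simp)

lemma octant_Re: "octant k z \<Longrightarrow> Re z \<noteq> 0 \<Longrightarrow> \<bar>Re z\<bar> = 2 ^ (k div 2)"
  by (auto simp: octant_def split: if_splits)

section \<open>Classification of the words of the full design and their aliasing indices\<close>

definition odd_entries :: "4 ^ 'n \<Rightarrow> 'n set" where
  "odd_entries v = {i. v $ i = 1 \<or> v $ i = 3}"

text \<open>With both columns of v present the frequency at i is 2 v_i, which is 2 for odd v_i and 0
  otherwise; nonzero local sums then force exactly these slices.\<close>

definition full_word :: "4 ^ 'n \<Rightarrow> ('n option \<times> bool) set" where
  "full_word v = {(j, h). case j of None \<Rightarrow> True | Some i \<Rightarrow> i \<in> odd_entries v}"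

text \<open>The index of such a set may be 1, namely when v has at most one odd entry.\<close>

definition partial_words :: "4 ^ 'n \<Rightarrow> ('n option \<times> bool) set set" where
  "partial_words v = {s. (s `` {None} = {False} \<or> s `` {None} = {True})
                         \<and> j_char (generated_design (generator v)) s \<noteq> 0}"

lemma set_eq_slicesI:
  assumes "s `` {None} = t `` {None}" "\<And>i. s `` {Some i} = t `` {Some i}"
  shows "s = t"
proof -
  have "s `` {j} = t `` {j}" for j using assms by (cases j) auto
  then have "(SIGMA j:UNIV. s `` {j}) = (SIGMA j:UNIV. t `` {j})" by (simp only:)
  then show ?thesis unfolding Sigma_slices .
qed

lemma gray_coeff_nonzero:
  assumes "gray_coeff a S \<noteq> 0"
  shows "a = 0 \<Longrightarrow> S = {}" "a = 2 \<Longrightarrow> S = UNIV" "a = 1 \<or> a = 3 \<Longrightarrow> S = {False} \<or> S = {True}"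
  using assms by (auto simp: gray_coeff_0 gray_coeff_1 gray_coeff_2 gray_coeff_3 split: if_splits)

lemma gray_coeff_odd:
  assumes "a = 1 \<or> a = 3" "S = {False} \<or> S = {True}"
  shows "gray_coeff a S / 2 \<in> {1 + \<i>, 1 - \<i>}"
  using assms by (elim disjE) (simp_all add: gray_coeff_1 gray_coeff_3)

lemma j_char_nonzero_gray_coeff:
  assumes "j_char (generated_design (generator v)) s \<noteq> 0"
  shows "gray_coeff (freq (s `` {None}) * v $ i) (s `` {Some i}) \<noteq> 0"
proof
  assume "gray_coeff (freq (s `` {None}) * v $ i) (s `` {Some i}) = 0"
  then have "(\<Prod>i\<in>UNIV. gray_coeff (freq (s `` {None}) * v $ i) (s `` {Some i})) = 0"
    by (intro prod_zero) auto
  then have "real_of_int (j_char (generated_design (generator v)) s) = 0"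
    by (simp only: j_char_generator) simp
  then show False using assms by simp
qed

lemma full_word_slices:
  "full_word v `` {None} = UNIV"
  "full_word v `` {Some i} = (if i \<in> odd_entries v then UNIV else {})"
  by (auto simp: full_word_def)

text \<open>Doubling in Z_4 keeps only the parity of v_i, and the slices are chosen so that every
  local sum has the maximal value 4.\<close>

lemma j_char_full_word: "j_char (generated_design (generator v)) (full_word v) = 4 ^ CARD('n)"
  for v :: "4 ^ 'n"
proof -
  have "2 * v $ i = (if i \<in> odd_entries v then 2 else 0)" for i
    using Z4_cases[of "v $ i"] by (auto simp: odd_entries_def)
  then have "gray_coeff (2 * v $ i) (if i \<in> odd_entries v then UNIV else {}) = 4" for i
    by (simp add: gray_coeff_0 gray_coeff_2)
  then have "real_of_int (j_char (generated_design (generator v)) (full_word v)) =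
      Re (complex_of_real (4 ^ CARD('n)))"
    by (simp only: j_char_generator full_word_slices) (simp add: phase_def freq_def UNIV_bool)
  then show ?thesis
    by (metis Re_complex_of_real of_int_eq_iff of_int_numeral of_int_power)
qed

text \<open>The slice at the column of v fixes the frequency as 0, 2 or 1. In the first two cases
  the nonvanishing local sums determine every other slice.\<close>

lemma j_char_nonzero_cases:
  assumes J: "j_char (generated_design (generator v)) s \<noteq> 0"
  shows "s = {} \<or> s = full_word v \<or> s \<in> partial_words v"
proof -
  note nz = gray_coeff_nonzero[OF j_char_nonzero_gray_coeff[OF J]]
  consider "s `` {None} = {}" | "s `` {None} = UNIV" | "s `` {None} = {False} \<or> s `` {None} = {True}"
    using bool_set_cases by metis
  then show ?thesis
  proof cases
    case 1
    then have "s `` {Some i} = {}" for i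
      by (intro nz(1)) (simp add: freq_def)
    then have "s = {}" using 1 by (intro set_eq_slicesI) auto
    then show ?thesis by simp
  next
    case 2
    then have "freq (s `` {None}) = 2" by (simp add: freq_def UNIV_bool)
    then have "s `` {Some i} = full_word v `` {Some i}" for i
      using nz(1,2)[of i] Z4_cases[of "v $ i"] by (auto simp: full_word_slices odd_entries_def)
    then have "s = full_word v"
      using 2 by (intro set_eq_slicesI) (simp_all add: full_word_slices)
    then show ?thesis by simp
  next
    case 3
    then show ?thesis using J by (simp add: partial_words_def)
  qed
qed

lemma partial_words_None:
  "s \<in> partial_words v \<Longrightarrow> s `` {None} = {False} \<or> s `` {None} = {True}"
  by (simp add: partial_words_def)

lemma partial_words_None_neq_UNIV: "s \<in> partial_words v \<Longrightarrow> s `` {None} \<noteq> UNIV"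
proof -
  have "{False} \<noteq> UNIV" "{True} \<noteq> UNIV" by (auto simp: UNIV_bool)
  then show "s \<in> partial_words v \<Longrightarrow> s `` {None} \<noteq> UNIV"
    using partial_words_None by metis
qed

lemma partial_words_slices:
  assumes "s \<in> partial_words v"
  shows "v $ i = 0 \<Longrightarrow> s `` {Some i} = {}"
    and "v $ i = 2 \<Longrightarrow> s `` {Some i} = UNIV"
    and "i \<in> odd_entries v \<Longrightarrow> s `` {Some i} = {False} \<or> s `` {Some i} = {True}"
proof -
  have "freq (s `` {None}) = 1" and J: "j_char (generated_design (generator v)) s \<noteq> 0"
    using assms by (auto simp: partial_words_def freq_def UNIV_bool)
  then show "v $ i = 0 \<Longrightarrow> s `` {Some i} = {}" "v $ i = 2 \<Longrightarrow> s `` {Some i} = UNIV"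
    "i \<in> odd_entries v \<Longrightarrow> s `` {Some i} = {False} \<or> s `` {Some i} = {True}"
    using gray_coeff_nonzero[OF j_char_nonzero_gray_coeff[OF J]]
    by (simp_all add: odd_entries_def)
qed

text \<open>Let m be the number of odd entries. Each even entry contributes 4, each odd one 2 (1 +-
  i), and the phase is one further factor 1 +- i. The real part of the m + 1 such factors is
  nonzero, hence +- 2^((m + 1) div 2).\<close>

lemma abs_j_char_partial_word:
  fixes v :: "4 ^ 'n"
  assumes s: "s \<in> partial_words v"
  shows "\<bar>real_of_int (j_char (generated_design (generator v)) s)\<bar> =
           4 ^ CARD('n) / 2 ^ (card (odd_entries v) div 2)"
proof -
  have Re_mult: "Re (complex_of_real r * z) = r * Re z" for r z
    by simp
  define w where "w i = gray_coeff (v $ i) (s `` {Some i}) / 2" for i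
  let ?O = "odd_entries v" and ?m = "card (odd_entries v)"
  have None: "s `` {None} = {False} \<or> s `` {None} = {True}"
    using s by (simp add: partial_words_def)
  have freq: "freq (s `` {None}) = 1"
    using None by (auto simp: freq_def UNIV_bool)
  have w: "w i \<in> {1 + \<i>, 1 - \<i>}" if "i \<in> ?O" for i
    using partial_words_slices(3)[OF s that] that
    unfolding w_def odd_entries_def by (intro gray_coeff_odd) auto
  have "octant 1 (phase (s `` {None}))"
    using None by (auto simp: phase_def octant_def)
  then have oct: "octant (1 + ?m) (phase (s `` {None}) * prod w ?O)"
    by (rule octant_prod) (use w in auto)
  have even: "gray_coeff (v $ i) (s `` {Some i}) = 4" if "i \<notin> ?O" for i
    using partial_words_slices(1,2)[OF s, of i] that Z4_cases[of "v $ i"]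
    by (auto simp: odd_entries_def gray_coeff_0 gray_coeff_2)
  have le: "?m \<le> CARD('n)" by (intro card_mono) auto
  have "(\<Prod>i\<in>UNIV. gray_coeff (v $ i) (s `` {Some i})) =
      (\<Prod>i\<in>?O. gray_coeff (v $ i) (s `` {Some i})) * (\<Prod>i\<in>-?O. gray_coeff (v $ i) (s `` {Some i}))"
    by (subst prod.union_disjoint[symmetric]) auto
  also have "(\<Prod>i\<in>-?O. gray_coeff (v $ i) (s `` {Some i})) = 4 ^ (CARD('n) - ?m)"
    using even by (simp add: Compl_eq_Diff_UNIV card_Diff_subset)
  also have "(\<Prod>i\<in>?O. gray_coeff (v $ i) (s `` {Some i})) = 2 ^ ?m * prod w ?O"
    by (simp add: w_def prod_dividef)
  finally have coeffs: "(\<Prod>i\<in>UNIV. gray_coeff (v $ i) (s `` {Some i})) =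
      complex_of_real (2 ^ ?m * 4 ^ (CARD('n) - ?m)) * prod w ?O"
    by simp
  have "real_of_int (j_char (generated_design (generator v)) s) =
      Re (phase (s `` {None}) * (\<Prod>i\<in>UNIV. gray_coeff (v $ i) (s `` {Some i})))"
    by (simp only: j_char_generator freq mult_1_left)
  also have "\<dots> = Re (complex_of_real (2 ^ ?m * 4 ^ (CARD('n) - ?m)) * (phase (s `` {None}) * prod w ?O))"
    unfolding coeffs by (simp only: mult.left_commute)
  finally have J: "real_of_int (j_char (generated_design (generator v)) s) =
      2 ^ ?m * 4 ^ (CARD('n) - ?m) * Re (phase (s `` {None}) * prod w ?O)"
    unfolding Re_mult .
  have "j_char (generated_design (generator v)) s \<noteq> 0"
    using s by (simp add: partial_words_def)
  then have "Re (phase (s `` {None}) * prod w ?O) \<noteq> 0"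
    using J by (metis mult_zero_right of_int_eq_0_iff)
  then have "\<bar>Re (phase (s `` {None}) * prod w ?O)\<bar> = 2 ^ (Suc ?m div 2)"
    using octant_Re[OF oct] by simp
  then have "\<bar>real_of_int (j_char (generated_design (generator v)) s)\<bar> =
      2 ^ ?m * 4 ^ (CARD('n) - ?m) * 2 ^ (Suc ?m div 2)"
    unfolding J abs_mult by simp
  also have "\<dots> = 4 ^ CARD('n) / 2 ^ (?m div 2)"
  proof -
    \<comment> \<open>The ceiling and the floor of m / 2 add up to m, which turns a power in the
      numerator into the stated denominator.\<close>
    have "Suc ?m div 2 + ?m div 2 = ?m" by presburger
    then have half: "(2::real) ^ (Suc ?m div 2) * 2 ^ (?m div 2) = 2 ^ ?m"
      by (metis power_add)
    have "(2 ^ ?m * 4 ^ (CARD('n) - ?m) * 2 ^ (Suc ?m div 2)) * 2 ^ (?m div 2) =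
        (2 ^ ?m * 4 ^ (CARD('n) - ?m) * (2 ^ (Suc ?m div 2) * 2 ^ (?m div 2)) :: real)"
      by (simp only: mult.assoc)
    also have "\<dots> = (2 * 2) ^ ?m * 4 ^ (CARD('n) - ?m)"
      unfolding half power_mult_distrib by (simp only: ac_simps)
    also have "\<dots> = 4 ^ CARD('n)"
      using le by (simp add: power_add[symmetric, of "4::real"])
    finally show ?thesis by (simp add: field_simps)
  qed
  finally show ?thesis .
qed

lemma words_generator: "words (generated_design (generator v)) = insert (full_word v) (partial_words v)"
proof -
  have "full_word v \<noteq> {}"
    using full_word_slices(1)[of v] by auto
  moreover have "s \<noteq> {}" if "s \<in> partial_words v" for s
    using that by (auto simp: partial_words_def)
  moreover have j_char_partial_word: "j_char (generated_design (generator v)) s \<noteq> 0"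
    if "s \<in> partial_words v" for s
    using that by (simp add: partial_words_def)
  ultimately show ?thesis
    using j_char_nonzero_cases[of v] j_char_full_word[of v] j_char_partial_word
    by (intro set_eqI) (simp add: mem_words_iff, metis power_eq_0_iff zero_neq_numeral)
qed

lemma full_word_notin_partial_words: "full_word v \<notin> partial_words v"
  by (simp add: partial_words_def full_word_slices UNIV_bool)

lemma aliasing_index_full_word: "aliasing_index (generated_design (generator v)) (full_word v) = 1"
  by (simp add: aliasing_index_def j_char_full_word card_Z4_vec)

lemma aliasing_index_partial_word:
  assumes "s \<in> partial_words v"
  shows "aliasing_index (generated_design (generator v)) s = 1 / 2 ^ (card (odd_entries v) div 2)"
  by (simp add: aliasing_index_def abs_j_char_partial_word[OF assms] card_Z4_vec)

section \<open>Lengths of the words and number of partial words\<close>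

lemma card_full_word: "card (full_word v) = 2 * card (odd_entries v) + 2"
  by (simp add: card_eq_sum_slices[of "full_word v"] sum_UNIV_option full_word_slices if_distrib
      sum.If_cases cong: if_cong)

lemma card_partial_word:
  assumes s: "s \<in> partial_words v"
  shows "card s = card (odd_entries v) + 2 * card {i. v $ i = 2} + 1"
proof -
  have "card (s `` {Some i}) = (if i \<in> odd_entries v then 1 else 0) + 2 * (if v $ i = 2 then 1 else 0)" for i
  proof (cases "i \<in> odd_entries v")
    case True
    then have "v $ i \<noteq> 2" by (auto simp: odd_entries_def)
    moreover have "card (s `` {Some i}) = 1"
      using partial_words_slices(3)[OF s True] by (elim disjE) simp_all
    ultimately show ?thesis using True by simp
  next
    case False
    then have "v $ i = 0 \<or> v $ i = 2"
      using Z4_cases[of "v $ i"] by (auto simp: odd_entries_def)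
    then show ?thesis
      using partial_words_slices(1,2)[OF s] False by (elim disjE) simp_all
  qed
  moreover have "card (s `` {None}) = 1"
    using partial_words_None[OF s] by (elim disjE) simp_all
  ultimately show ?thesis
    by (simp add: card_eq_sum_slices[of s] sum_UNIV_option sum.distrib sum.If_cases
        flip: sum_distrib_left)
qed

text \<open>With N = 4^n runs there are 4 N sets of columns, so the Parseval total is 4 N^2. The
  empty set and the full word take N^2 each; every partial word takes N^2 / 4^q with q = m div 2, m
  being the number of odd entries.\<close>

lemma card_partial_words:
  fixes v :: "4 ^ 'n"
  shows "card (partial_words v) = 2 * (2 ^ (card (odd_entries v) div 2))\<^sup>2"
proof -
  let ?D = "generated_design (generator v)" and ?q = "card (odd_entries v) div 2"
  let ?N = "4 ^ CARD('n) :: real"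
  \<comment> \<open>The identity block makes the Gray bits of every coordinate of the run available
    as entries, so different runs differ somewhere.\<close>
  have distinct: "\<exists>c\<in>cols ?D. entry ?D u c \<noteq> entry ?D u' c" if "u \<noteq> u'" for u u'
  proof -
    obtain i where "u $ i \<noteq> u' $ i" using \<open>u \<noteq> u'\<close> by (metis vec_eq_iff)
    then obtain h where "gray_bit h (u $ i) \<noteq> gray_bit h (u' $ i)" using gray_bits_inject by blast
    then have "entry ?D u (Some i, h) \<noteq> entry ?D u' (Some i, h)" by simp
    then show ?thesis unfolding cols_generated_design by blast
  qed
  have "(\<Sum>s\<in>Pow (cols ?D). (j_char ?D s)\<^sup>2) = 2 ^ card (cols ?D) * int (card (runs ?D))"
    by (intro parseval entry_generated_design_sq distinct) simp_all
  then have "(\<Sum>s\<in>UNIV. (j_char ?D s)\<^sup>2) = 2 ^ card (UNIV :: ('n option \<times> bool) set) * 4 ^ CARD('n)"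
    by (simp add: card_Z4_vec)
  also have "card (UNIV :: ('n option \<times> bool) set) = 2 * CARD('n) + 2"
    by (simp add: card_prod UNIV_option_conv card_image flip: UNIV_Times_UNIV)
  also have "(2::int) ^ (2 * CARD('n) + 2) = 4 * 4 ^ CARD('n)"
    by (simp add: power_add power_mult)
  finally have "real_of_int (\<Sum>s\<in>UNIV. (j_char ?D s)\<^sup>2) = real_of_int (4 * 4 ^ CARD('n) * 4 ^ CARD('n))"
    by (simp only:)
  then have total: "(\<Sum>s\<in>UNIV. (real_of_int (j_char ?D s))\<^sup>2) = 4 * ?N\<^sup>2"
    by (simp add: power2_eq_square)
  have "(\<Sum>s\<in>UNIV. (real_of_int (j_char ?D s))\<^sup>2) =
      (\<Sum>s\<in>insert {} (insert (full_word v) (partial_words v)). (real_of_int (j_char ?D s))\<^sup>2)"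
    by (rule sum.mono_neutral_right) (use j_char_nonzero_cases[of v] in auto)
  also have "\<dots> = ?N\<^sup>2 + (?N\<^sup>2 + (\<Sum>s\<in>partial_words v. (real_of_int (j_char ?D s))\<^sup>2))"
  proof -
    have "{} \<notin> insert (full_word v) (partial_words v)"
      unfolding words_generator[symmetric] by (simp add: mem_words_iff)
    moreover have "real_of_int (j_char ?D {}) = ?N"
      by (simp add: j_char_def card_Z4_vec)
    ultimately show ?thesis
      by (simp add: full_word_notin_partial_words j_char_full_word)
  qed
  also have "(\<Sum>s\<in>partial_words v. (real_of_int (j_char ?D s))\<^sup>2) =
      (\<Sum>s\<in>partial_words v. (?N / 2 ^ ?q)\<^sup>2)"
    by (intro sum.cong refl) (metis abs_j_char_partial_word power2_abs)
  finally have "real (card (partial_words v)) * (?N / 2 ^ ?q)\<^sup>2 = 2 * ?N\<^sup>2"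
    using total by simp
  then have "real (card (partial_words v)) = 2 * (2 ^ ?q)\<^sup>2"
    by (simp add: power_divide field_simps)
  then have "real (card (partial_words v)) = real (2 * (2 ^ ?q)\<^sup>2)"
    by simp
  then show ?thesis by (simp only: of_nat_eq_iff)
qed

lemma gray_swap_image_slice: "(gray_swap ` s) `` {j} = Not ` (s `` {j})"
  by (force simp: gray_swap_def image_iff)

lemma gray_swap_partial_words:
  assumes "s \<in> partial_words v"
  shows "gray_swap ` s \<in> partial_words v"
  using partial_words_None[OF assms] assms
  by (elim disjE) (simp_all add: partial_words_def gray_swap_image_slice j_char_gray_swap)

text \<open>A partial word contains exactly one of the two columns of an odd coordinate, so the
  involution \<open>gray_swap\<close> exchanges the words with and without a given one of
  them.\<close>

lemma card_partial_words_split: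
  assumes i: "i \<in> odd_entries v"
  shows "card {s \<in> partial_words v. (Some i, h) \<in> s} = (2 ^ (card (odd_entries v) div 2))\<^sup>2"
    and "card {s \<in> partial_words v. (Some i, h) \<notin> s} = (2 ^ (card (odd_entries v) div 2))\<^sup>2"
proof -
  let ?A = "{s \<in> partial_words v. (Some i, h) \<notin> s}" and ?B = "{s \<in> partial_words v. (Some i, h) \<in> s}"
  have flip: "(Some i, h) \<in> gray_swap ` s \<longleftrightarrow> (Some i, h) \<notin> s" if s: "s \<in> partial_words v" for s
  proof -
    have "(Some i, h) \<in> gray_swap ` s \<longleftrightarrow> h \<in> (gray_swap ` s) `` {Some i}" by simp
    also have "\<dots> \<longleftrightarrow> h \<notin> s `` {Some i}"
      unfolding gray_swap_image_slice using partial_words_slices(3)[OF s i] by (elim disjE) auto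
    finally show ?thesis by simp
  qed
  have "bij_betw ((`) gray_swap) ?A ?B"
  proof (rule bij_betw_byWitness[where f' = "(`) gray_swap"])
    show "(`) gray_swap ` ?A \<subseteq> ?B" "(`) gray_swap ` ?B \<subseteq> ?A"
      using flip gray_swap_partial_words by blast+
  qed (simp_all add: image_image)
  then have "card ?A = card ?B" by (rule bij_betw_same_card)
  moreover have "card (partial_words v) = card ?A + card ?B"
    by (subst card_Un_disjoint[symmetric]) (auto intro: arg_cong[where f = card])
  ultimately show "card ?B = (2 ^ (card (odd_entries v) div 2))\<^sup>2"
    "card ?A = (2 ^ (card (odd_entries v) div 2))\<^sup>2"
    by (simp_all add: card_partial_words)
qed

section \<open>Branching on a column of the identity block\<close>

lemma generator_word_pair:
  assumes i: "v $ i \<noteq> 0" and s: "s \<in> words (generated_design (generator v))"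
    and b: "(Some i, h) \<notin> s"
  shows "insert (Some i, h) s \<notin> words (generated_design (generator v))"
proof
  assume "insert (Some i, h) s \<in> words (generated_design (generator v))"
  then have s': "insert (Some i, h) s = full_word v \<or> insert (Some i, h) s \<in> partial_words v"
    by (simp add: words_generator)
  have s: "s = full_word v \<or> s \<in> partial_words v"
    using s by (simp add: words_generator)
  \<comment> \<open>Adjoining a column of coordinate i leaves the slice at v alone, so both words
    would be of the same kind. There is one full word; a partial word has exactly one column of i if
    v_i is odd, and already both if v_i = 2.\<close>
  have None: "insert (Some i, h) s `` {None} = s `` {None}"
    and Some: "insert (Some i, h) s `` {Some i} = insert h (s `` {Some i})"
    by auto
  have h: "h \<notin> s `` {Some i}" using b by simp
  show False
  proof (cases "s `` {None} = UNIV")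
    case True
    then have "s = full_word v" "insert (Some i, h) s = full_word v"
      using s s' None partial_words_None_neq_UNIV by metis+
    then show False using b by blast
  next
    case False
    then have P: "s \<in> partial_words v" "insert (Some i, h) s \<in> partial_words v"
      using s s' None full_word_slices(1)[of v] by metis+
    show False
    proof (cases "i \<in> odd_entries v")
      case True
      then show False
        using partial_words_slices(3)[OF P(1) True] partial_words_slices(3)[OF P(2) True] h
        unfolding Some by (elim disjE) simp_all
    next
      case False
      then have "v $ i = 2" using i Z4_cases[of "v $ i"] by (auto simp: odd_entries_def)
      then show False using partial_words_slices(2)[OF P(1)] h by auto
    qed
  qed
qed

text \<open>Balance of the branching column: every word contains a column of v.\<close>

lemma j_char_single_Some: "j_char (generated_design (generator v)) {(Some i, h)} = 0"
proof (rule ccontr)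
  assume "j_char (generated_design (generator v)) {(Some i, h)} \<noteq> 0"
  then consider "{(Some i, h)} = full_word v" | "{(Some i, h)} \<in> partial_words v"
    using j_char_nonzero_cases by blast
  moreover have None: "{(Some i, h)} `` {None} = {}" by auto
  ultimately show False
  proof cases
    case 1
    then show False using None full_word_slices(1)[of v] by simp
  next
    case 2
    then show False using None partial_words_None by (metis insert_not_empty)
  qed
qed

theorem theorem3:
  fixes v :: "4 ^ 'n"
    and b :: "'n option \<times> bool"
    and e :: int
    and f :: "4 \<Rightarrow> nat"
    and k1 k2 :: nat
    and \<rho> :: real
    and D' :: "(4 ^ 'n, 'n option \<times> bool) design"
  assumes f: "\<And>z. f z = card {i. v $ i = z}"
    and e: "e = 1 \<or> e = -1"
    and D': "D' = half_fraction (generated_design (generator v)) b e"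
    and k1: "k1 = f 1 + 2 * f 2 + f 3 + 1"
    and k2: "k2 = 2 * f 1 + 2 * f 3 + 2"
    and rho: "\<rho> = 2 powi (- \<lfloor>real (f 1 + f 3) / 2\<rfloor>)"
  shows "(associated_with v b 1 \<or> associated_with v b 3 \<longrightarrow>
            (\<exists>w A B. words D' = {w} \<union> A \<union> B
               \<and> w \<notin> A \<and> w \<notin> B \<and> A \<inter> B = {}
               \<and> w \<in> complete_words D' (k2 - 1)
               \<and> A \<subseteq> words_with D' k1 \<rho> \<and> real (card A) = 1 / \<rho>\<^sup>2
               \<and> B \<subseteq> words_with D' (k1 - 1) \<rho> \<and> real (card B) = 1 / \<rho>\<^sup>2))
       \<and> (associated_with v b 2 \<longrightarrow>
            (\<exists>w A. words D' = {w} \<union> A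
               \<and> w \<notin> A
               \<and> w \<in> complete_words D' k2
               \<and> A \<subseteq> words_with D' (k1 - 1) \<rho> \<and> real (card A) = 2 / \<rho>\<^sup>2))"
proof -
  let ?D = "generated_design (generator v)" and ?O = "odd_entries v"
  let ?P = "partial_words v" and ?w = "full_word v"
  define q where "q = card ?O div 2"
  have "?O = {i. v $ i = 1} \<union> {i. v $ i = 3}"
    by (auto simp: odd_entries_def)
  then have odd: "card ?O = f 1 + f 3"
    unfolding f by (simp add: card_Un_disjoint disjoint_iff)
  \<comment> \<open>The real floor agrees with natural division, so the integer power becomes 1 /
    2^q.\<close>
  have "\<lfloor>real (f 1 + f 3) / 2\<rfloor> = int q"
    unfolding q_def odd using floor_divide_of_nat_eq[of "f 1 + f 3" 2] by simp
  then have rho': "\<rho> = 1 / 2 ^ q"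
    by (simp only: rho power_int_minus power_int_of_nat inverse_eq_divide)
  have card_P: "card s = k1" if "s \<in> ?P" for s
    using card_partial_word[OF that] by (simp add: k1 odd f)
  have card_w: "card ?w = k2"
    by (simp add: card_full_word odd k2)
  \<comment> \<open>Valid for every branching column with v_i nonzero, hence shared by both
    claims.\<close>
  have words: "words D' = {s \<in> insert ?w ?P. b \<notin> s} \<union> (\<lambda>s. s - {b}) ` {s \<in> insert ?w ?P. b \<in> s}"
    and index: "\<And>s. s \<in> insert ?w ?P \<Longrightarrow> aliasing_index D' (s - {b}) = aliasing_index ?D s"
    if i: "fst b = Some i" "v $ i \<noteq> 0" for i
  proof -
    obtain h where b: "b = (Some i, h)" using i(1) by (metis prod.collapse)
    note hf = half_fraction_words[of ?D b e, OF _ _ _ e entry_generated_design_sq, folded D',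
        unfolded words_generator]
    show "words D' = {s \<in> insert ?w ?P. b \<notin> s} \<union> (\<lambda>s. s - {b}) ` {s \<in> insert ?w ?P. b \<in> s}"
      by (rule hf(1)) (use generator_word_pair[OF i(2), of _ h] in
          \<open>auto simp: b j_char_single_Some words_generator[symmetric]\<close>)
    show "aliasing_index D' (s - {b}) = aliasing_index ?D s" if "s \<in> insert ?w ?P" for s
      by (rule hf(2)[OF _ _ _ _ _ that]) (use generator_word_pair[OF i(2), of _ h] in
          \<open>auto simp: b j_char_single_Some words_generator[symmetric]\<close>)
  qed
  have index_P: "aliasing_index ?D s = \<rho>" if "s \<in> ?P" for s
    using aliasing_index_partial_word[OF that] by (simp add: rho' q_def)
  have inj: "inj_on (\<lambda>s. s - {b}) {s. b \<in> s}"
    by (rule inj_onI) (metis insert_Diff mem_Collect_eq)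
  \<comment> \<open>Deleting \<open>b\<close> does not touch the columns of v, so the slice there
    still separates the full word from the partial ones.\<close>
  have minus_None: "(s - {b}) `` {None} = s `` {None}" if "fst b = Some i" for s :: "('n option \<times> bool) set" and i
    using that by auto
  have "\<exists>w A B. words D' = {w} \<union> A \<union> B
      \<and> w \<notin> A \<and> w \<notin> B \<and> A \<inter> B = {}
      \<and> w \<in> complete_words D' (k2 - 1)
      \<and> A \<subseteq> words_with D' k1 \<rho> \<and> real (card A) = 1 / \<rho>\<^sup>2
      \<and> B \<subseteq> words_with D' (k1 - 1) \<rho> \<and> real (card B) = 1 / \<rho>\<^sup>2"
    if z: "associated_with v b 1 \<or> associated_with v b 3"
  proof -
    obtain i h where b: "b = (Some i, h)" and i: "i \<in> ?O"
      using z by (cases b) (auto simp: associated_with_def odd_entries_def)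
    have i0: "fst b = Some i" "v $ i \<noteq> 0"
      using i by (auto simp: b odd_entries_def)
    note words = words[OF i0] and index = index[OF i0] and minus_None = minus_None[OF i0(1)]
    have bw: "b \<in> ?w" using i by (simp add: b full_word_def)
    \<comment> \<open>Words avoiding \<open>b\<close> keep their length k1; those containing it drop
      to k1 - 1. The full word contains \<open>b\<close>, whence k2 - 1.\<close>
    define A where "A = {s \<in> ?P. b \<notin> s}"
    define B where "B = (\<lambda>s. s - {b}) ` {s \<in> ?P. b \<in> s}"
    define w where "w = ?w - {b}"
    have W: "words D' = {w} \<union> A \<union> B"
      unfolding words A_def B_def w_def using bw by auto
    have "w `` {None} = UNIV"
      unfolding w_def minus_None by (rule full_word_slices)
    moreover have "t `` {None} \<noteq> UNIV" if "t \<in> A \<union> B" for t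
      using that partial_words_None_neq_UNIV minus_None unfolding A_def B_def by blast
    ultimately have wA: "w \<notin> A" and wB: "w \<notin> B"
      by blast+
    \<comment> \<open>The slice at i tells the two families apart: deletion of \<open>b\<close>
      empties it in \<open>B\<close>, while in \<open>A\<close> it is a singleton.\<close>
    have "t `` {Some i} = {}" if "t \<in> B" for t
    proof -
      obtain s where s: "s \<in> ?P" "b \<in> s" "t = s - {b}"
        using \<open>t \<in> B\<close> by (auto simp: B_def)
      have "h \<in> s `` {Some i}" using s(2) b by simp
      then have "s `` {Some i} = {h}"
        using partial_words_slices(3)[OF s(1) i] by (elim disjE) simp_all
      moreover have "t `` {Some i} = s `` {Some i} - {h}" unfolding s(3) b by auto
      ultimately show ?thesis by simp
    qed
    moreover have "t `` {Some i} \<noteq> {}" if "t \<in> A" for t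
      using partial_words_slices(3)[of t v i] that i unfolding A_def by auto
    ultimately have AB: "A \<inter> B = {}" by blast
    have comp: "w \<in> complete_words D' (k2 - 1)"
      using W index[of ?w] bw
      by (simp add: complete_words_def words_with_def w_def aliasing_index_full_word card_w)
    have A: "A \<subseteq> words_with D' k1 \<rho>"
    proof
      fix s assume s: "s \<in> A"
      then have "s - {b} = s" "s \<in> ?P" by (auto simp: A_def)
      then show "s \<in> words_with D' k1 \<rho>"
        using W s index[of s] index_P card_P by (simp add: words_with_def)
    qed
    have B: "B \<subseteq> words_with D' (k1 - 1) \<rho>"
    proof
      fix t assume t: "t \<in> B"
      then obtain s where s: "s \<in> ?P" "b \<in> s" "t = s - {b}"
        by (auto simp: B_def)
      then show "t \<in> words_with D' (k1 - 1) \<rho>"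
        using W t index[of s] index_P card_P by (simp add: words_with_def)
    qed
    have "card B = card {s \<in> ?P. b \<in> s}"
      unfolding B_def by (rule card_image) (rule inj_on_subset[OF inj], auto)
    then have cards: "real (card A) = 1 / \<rho>\<^sup>2" "real (card B) = 1 / \<rho>\<^sup>2"
      using card_partial_words_split[OF i, of h]
      by (simp_all add: A_def b rho' q_def power_divide)
    show ?thesis
      using W wA wB AB comp A B cards by blast
  qed
  moreover have "\<exists>w A. words D' = {w} \<union> A
      \<and> w \<notin> A
      \<and> w \<in> complete_words D' k2
      \<and> A \<subseteq> words_with D' (k1 - 1) \<rho> \<and> real (card A) = 2 / \<rho>\<^sup>2"
    if z: "associated_with v b 2"
  proof -
    obtain i h where b: "b = (Some i, h)" and i: "v $ i = 2"
      using z by (cases b) (auto simp: associated_with_def)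
    have i0: "fst b = Some i" "v $ i \<noteq> 0"
      using i by (auto simp: b)
    note words = words[OF i0] and index = index[OF i0] and minus_None = minus_None[OF i0(1)]
    have bw: "b \<notin> ?w" using i by (simp add: b full_word_def odd_entries_def)
    \<comment> \<open>The entry 2 forces both columns of i into every partial word, so all of them
      lose one column; the full word avoids i and keeps length k2.\<close>
    have bP: "b \<in> s" if "s \<in> ?P" for s
      using partial_words_slices(2)[OF that i] b by auto
    define A where "A = (\<lambda>s. s - {b}) ` ?P"
    have W: "words D' = {?w} \<union> A"
      unfolding words A_def using bw bP by auto
    have wA: "?w \<notin> A"
    proof
      assume "?w \<in> A"
      then obtain s where "s \<in> ?P" "?w = s - {b}" by (auto simp: A_def)
      then show False using partial_words_None_neq_UNIV minus_None[of s] full_word_slices(1)[of v] by metis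
    qed
    have comp: "?w \<in> complete_words D' k2"
      using W index[of ?w] bw
      by (simp add: complete_words_def words_with_def aliasing_index_full_word card_w)
    have A: "A \<subseteq> words_with D' (k1 - 1) \<rho>"
    proof
      fix t assume t: "t \<in> A"
      then obtain s where s: "s \<in> ?P" "t = s - {b}"
        by (auto simp: A_def)
      then show "t \<in> words_with D' (k1 - 1) \<rho>"
        using W t index[of s] index_P card_P bP by (simp add: words_with_def)
    qed
    have "card A = card ?P"
      unfolding A_def by (rule card_image) (rule inj_on_subset[OF inj], use bP in auto)
    then have "real (card A) = 2 / \<rho>\<^sup>2"
      by (simp add: card_partial_words rho' q_def power_divide)
    then show ?thesis
      using W wA comp A by blast
  qed
  ultimately show ?thesis by blast
qed

end
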